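(* Let $(Q,\cdot)$ be a quasigroup. For $j\in\{1,2,3\}$ put $v(1)=r$, $v(2)=l$, $v(3)=m$. Then for all $\sigma\in S_3$ the following hold. (1) With $v=v(\sigma^{-1}2)$: $\left({}^{\sigma}N_l^A\right)^{-1}={}^{\sigma^{-1}}N_v^A$; further, $\left({}^{\sigma}_{1}N_l^A\right)^{-1}={}^{\sigma^{-1}}_{\sigma^{-1}1}N_v^A$ and $\left({}^{\sigma}_{3}N_l^A\right)^{-1}={}^{\sigma^{-1}}_{\sigma^{-1}3}N_v^A$. (2) With $v=v(\sigma^{-1}1)$: $\left({}^{\sigma}N_r^A\right)^{-1}={}^{\sigma^{-1}}N_v^A$; further, $\left({}^{\sigma}_{2}N_r^A\right)^{-1}={}^{\sigma^{-1}}_{\sigma^{-1}2}N_v^A$ and $\left({}^{\sigma}_{3}N_r^A\right)^{-1}={}^{\sigma^{-1}}_{\sigma^{-1}3}N_v^A$. (3) With $v=v(\sigma^{-1}3)$: $\left({}^{\sigma}N_m^A\right)^{-1}={}^{\sigma^{-1}}N_v^A$; further, $\left({}^{\sigma}_{1}N_m^A\right)^{-1}={}^{\sigma^{-1}}_{\sigma^{-1}1}N_v^A$ and $\left({}^{\sigma}_{2}N_m^A\right)^{-1}={}^{\sigma^{-1}}_{\sigma^{-1}2}N_v^A$.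
   Context: A quasigroup $(Q,A)$ is a set $Q$ with a binary operation $A$ such that for all $a,b\in Q$ the equations $A(x,a)=b$ and $A(a,y)=b$ have unique solutions $x,y\in Q$. (In the claim, $A$ as an operation is written $\cdot$.) Conventions. Products in $S_3$ are computed from left to right, i.e. $(\sigma\tau)i=\tau(\sigma i)$, and $\sigma i$ is the image of $i$ under $\sigma$; $\varepsilon$ denotes an identity permutation (of $Q$ or in $S_3$). Permutations of $Q$ are composed as functions, $(\alpha\beta)(x)=\alpha(\beta(x))$. Triples of permutations of $Q$ are multiplied and inverted componentwise. For a triple $R=(\alpha_1,\alpha_2,\alpha_3)$ and $\tau\in S_3$, $R^{\tau}=(\alpha_{\tau^{-1}1},\alpha_{\tau^{-1}2},\alpha_{\tau^{-1}3})$. For $\sigma\in S_3$ the $\sigma$-parastrophe $A^\sigma$ of a quasigroup operation $A$ is the quasigroup operation determined by: $A(x_1,x_2)=x_3$ if and only if $A^{\sigma}(x_{\sigma^{-1}1},x_{\sigma^{-1}2})=x_{\sigma^{-1}3}$. For $\sigma\in S_3$ and a triple $R=(\alpha_1,\alpha_2,\alpha_3)$ of permutations of $Q$, the isostrophic image $A(\sigma,R)=(A^\sigma)R$ is the operation $B(x_1,x_2)=\alpha_3^{-1}\bigl(A^\sigma(\alpha_1x_1,\alpha_2x_2)\bigr)$. Pairs $(\sigma,R)$ are multiplied by $(\sigma,R)(\tau,S)=(\sigma\tau,R^{\tau}S)$, with inverses $(\sigma,R)^{-1}=(\sigma^{-1},(R^{-1})^{\sigma^{-1}})$. An autostrophism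 of $(Q,A)$ is a pair $(\sigma,R)$ with $A(\sigma,R)=A$; the set $Aus(Q,A)$ of all of them is a group under this multiplication. For $\sigma\in S_3$, the left (respectively right, middle) $\sigma$-A-nucleus ${}^{\sigma}N_l^A$ (respectively ${}^{\sigma}N_r^A$, ${}^{\sigma}N_m^A$) of a quasigroup is the set of all its autostrophisms of the form $(\sigma,(\alpha,\varepsilon,\gamma))$ (respectively $(\sigma,(\varepsilon,\beta,\gamma))$, $(\sigma,(\alpha,\beta,\varepsilon))$), with $\alpha,\beta,\gamma$ permutations of $Q$; here the superscript $A$ is just a symbol standing for "autotopy". These sets may be empty. For $v\in\{l,r,m\}$ and $i\in\{1,2,3\}$, ${}^{\sigma}_{i}N_v^A$ denotes the set of all $i$-th components $\alpha_i$ of elements $(\sigma,(\alpha_1,\alpha_2,\alpha_3))$ of ${}^{\sigma}N_v^A$. For a subset $B$ of a group, $B^{-1}=\{b^{-1}: b\in B\}$; for nuclei the group is $Aus(Q,\cdot)$, for component sets it is the group of permutations of $Q$. *)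

theory Defs
  imports "HOL-Combinatorics.Permutations"
begin

text \<open>A quasigroup with carrier \<open>Q\<close>; values of \<open>A\<close> outside \<open>Q\<close> are irrelevant.\<close>

definition quasigroup :: "'a set \<Rightarrow> ('a \<Rightarrow> 'a \<Rightarrow> 'a) \<Rightarrow> bool" where
  "quasigroup Q A \<longleftrightarrow>
     (\<forall>a\<in>Q. \<forall>b\<in>Q. A a b \<in> Q) \<and>
     (\<forall>a\<in>Q. \<forall>b\<in>Q. (\<exists>!x. x \<in> Q \<and> A x a = b) \<and> (\<exists>!y. y \<in> Q \<and> A a y = b))"

abbreviation S3 :: "(nat \<Rightarrow> nat) set" where
  "S3 \<equiv> {\<sigma>. \<sigma> permutes {1, 2, 3}}"

text \<open>Products in \<open>S3\<close> are computed from left to right.\<close>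

definition S3_mult :: "(nat \<Rightarrow> nat) \<Rightarrow> (nat \<Rightarrow> nat) \<Rightarrow> nat \<Rightarrow> nat" where
  "S3_mult \<sigma> \<tau> = (\<lambda>i. \<tau> (\<sigma> i))"

type_synonym 'a triple = "('a \<Rightarrow> 'a) \<times> ('a \<Rightarrow> 'a) \<times> ('a \<Rightarrow> 'a)"

text \<open>The \<open>i\<close>-th component of a triple; only \<open>i \<in> {1, 2, 3}\<close> is meaningful.\<close>

definition component :: "nat \<Rightarrow> 'a triple \<Rightarrow> 'a \<Rightarrow> 'a" where
  "component i R = (case R of (\<alpha>, \<beta>, \<gamma>) \<Rightarrow> if i = 1 then \<alpha> else if i = 2 then \<beta> else \<gamma>)"

text \<open>Permutations of \<open>Q\<close> are functions on the whole type that fix every point outside \<open>Q\<close>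
  (this is what \<open>permutes\<close> says), so \<open>id\<close>, \<open>\<circ>\<close> and \<open>inv\<close> are the group operations on them.\<close>

definition perm_triples :: "'a set \<Rightarrow> 'a triple set" where
  "perm_triples Q = {(\<alpha>, \<beta>, \<gamma>). \<alpha> permutes Q \<and> \<beta> permutes Q \<and> \<gamma> permutes Q}"

definition triple_mult :: "'a triple \<Rightarrow> 'a triple \<Rightarrow> 'a triple" where
  "triple_mult R S = (component 1 R \<circ> component 1 S,
     component 2 R \<circ> component 2 S, component 3 R \<circ> component 3 S)"

definition triple_inv :: "'a triple \<Rightarrow> 'a triple" where
  "triple_inv R = (inv (component 1 R), inv (component 2 R), inv (component 3 R))"

definition triple_permute :: "'a triple \<Rightarrow> (nat \<Rightarrow> nat) \<Rightarrow> 'a triple" where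
  "triple_permute R \<tau> =
     (component (inv \<tau> 1) R, component (inv \<tau> 2) R, component (inv \<tau> 3) R)"

text \<open>The tuple \<open>(x\<^sub>1, x\<^sub>2, x\<^sub>3)\<close> is represented by a function \<open>x\<close> on indices.  That the description
  below really determines a value is \<open>parastrophe_iff\<close>.\<close>

definition parastrophe ::
  "'a set \<Rightarrow> ('a \<Rightarrow> 'a \<Rightarrow> 'a) \<Rightarrow> (nat \<Rightarrow> nat) \<Rightarrow> 'a \<Rightarrow> 'a \<Rightarrow> 'a" where
  "parastrophe Q A \<sigma> y1 y2 = (THE y3. \<exists>x. x ` {1, 2, 3} \<subseteq> Q \<and> A (x 1) (x 2) = x 3 \<and>
     x (inv \<sigma> 1) = y1 \<and> x (inv \<sigma> 2) = y2 \<and> x (inv \<sigma> 3) = y3)"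

definition isostrophic_image ::
  "'a set \<Rightarrow> ('a \<Rightarrow> 'a \<Rightarrow> 'a) \<Rightarrow> (nat \<Rightarrow> nat) \<times> 'a triple \<Rightarrow> 'a \<Rightarrow> 'a \<Rightarrow> 'a" where
  "isostrophic_image Q A = (\<lambda>(\<sigma>, R) x1 x2.
     inv (component 3 R) (parastrophe Q A \<sigma> (component 1 R x1) (component 2 R x2)))"

definition pair_mult :: "(nat \<Rightarrow> nat) \<times> 'a triple \<Rightarrow> (nat \<Rightarrow> nat) \<times> 'a triple \<Rightarrow>
    (nat \<Rightarrow> nat) \<times> 'a triple" where
  "pair_mult = (\<lambda>(\<sigma>, R) (\<tau>, S). (S3_mult \<sigma> \<tau>, triple_mult (triple_permute R \<tau>) S))"

definition pair_inv :: "(nat \<Rightarrow> nat) \<times> 'a triple \<Rightarrow> (nat \<Rightarrow> nat) \<times> 'a triple" where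
  "pair_inv = (\<lambda>(\<sigma>, R). (inv \<sigma>, triple_permute (triple_inv R) (inv \<sigma>)))"

definition pair_one :: "(nat \<Rightarrow> nat) \<times> 'a triple" where
  "pair_one = (id, (id, id, id))"

text \<open>Equality of operations is equality on \<open>Q \<times> Q\<close>.\<close>

definition Aus :: "'a set \<Rightarrow> ('a \<Rightarrow> 'a \<Rightarrow> 'a) \<Rightarrow> ((nat \<Rightarrow> nat) \<times> 'a triple) set" where
  "Aus Q A = {(\<sigma>, R). \<sigma> \<in> S3 \<and> R \<in> perm_triples Q \<and>
     (\<forall>x1\<in>Q. \<forall>x2\<in>Q. isostrophic_image Q A (\<sigma>, R) x1 x2 = A x1 x2)}"

datatype side = Left | Right | Middle

fun nucleus :: "side \<Rightarrow> 'a set \<Rightarrow> ('a \<Rightarrow> 'a \<Rightarrow> 'a) \<Rightarrow> (nat \<Rightarrow> nat) \<Rightarrow>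
    ((nat \<Rightarrow> nat) \<times> 'a triple) set" where
  "nucleus Left Q A \<sigma> = {p \<in> Aus Q A. \<exists>\<alpha> \<gamma>. p = (\<sigma>, (\<alpha>, id, \<gamma>))}"
| "nucleus Right Q A \<sigma> = {p \<in> Aus Q A. \<exists>\<beta> \<gamma>. p = (\<sigma>, (id, \<beta>, \<gamma>))}"
| "nucleus Middle Q A \<sigma> = {p \<in> Aus Q A. \<exists>\<alpha> \<beta>. p = (\<sigma>, (\<alpha>, \<beta>, id))}"

definition nucleus_component :: "nat \<Rightarrow> side \<Rightarrow> 'a set \<Rightarrow> ('a \<Rightarrow> 'a \<Rightarrow> 'a) \<Rightarrow> (nat \<Rightarrow> nat) \<Rightarrow>
    ('a \<Rightarrow> 'a) set" where
  "nucleus_component i v Q A \<sigma> = (\<lambda>(\<tau>, T). component i T) ` nucleus v Q A \<sigma>"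

definition side_of :: "nat \<Rightarrow> side" where
  "side_of j = (if j = 1 then Right else if j = 2 then Left else Middle)"


subsection \<open>Well-definedness of parastrophes and the group of autostrophisms\<close>

lemma S3_cases:
  assumes "p \<in> S3"
  obtains "p 1 = 1" "p 2 = 2" "p 3 = 3" | "p 1 = 1" "p 2 = 3" "p 3 = 2"
    | "p 1 = 2" "p 2 = 1" "p 3 = 3" | "p 1 = 2" "p 2 = 3" "p 3 = 1"
    | "p 1 = 3" "p 2 = 1" "p 3 = 2" | "p 1 = 3" "p 2 = 2" "p 3 = (1::nat)"
proof -
  have p: "p permutes {1, 2, 3}" using assms by simp
  have "p 1 \<in> {1,2,3}" "p 2 \<in> {1,2,3}" "p 3 \<in> {1,2,3}"
    using permutes_in_image[OF p] by auto
  moreover have "p 1 \<noteq> p 2" "p 1 \<noteq> p 3" "p 2 \<noteq> p 3"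
    by (simp_all add: inj_eq[OF permutes_inj[OF p]])
  ultimately show ?thesis using that by simp metis
qed

lemma S3_closed: "p \<in> S3 \<Longrightarrow> i \<in> {1, 2, 3} \<Longrightarrow> p i \<in> {1, 2, 3}"
  by (metis mem_Collect_eq permutes_in_image)

lemma S3_ball: "p \<in> S3 \<Longrightarrow> (\<forall>i\<in>{1, 2, 3}. P i) \<longleftrightarrow> P (p 1) \<and> P (p 2) \<and> P (p 3)"
  by (erule S3_cases; simp; blast)

lemma graph_unique:
  assumes A: "quasigroup Q A" and p: "p \<in> S3"
    and x: "x ` {1, 2, 3} \<subseteq> Q" "A (x 1) (x 2) = x 3"
    and y: "y ` {1, 2, 3} \<subseteq> Q" "A (y 1) (y 2) = y 3"
    and eq: "x (p 1) = y (p 1)" "x (p 2) = y (p 2)"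
  shows "x 1 = y 1 \<and> x 2 = y 2 \<and> x (3::nat) = y 3"
proof -
  have c: "a = a'" if "a \<in> Q" "a' \<in> Q" "b \<in> Q" "A a b = A a' b" for a a' b
    using A that unfolding quasigroup_def by metis
  have d: "b = b'" if "a \<in> Q" "b' \<in> Q" "b \<in> Q" "A a b = A a b'" for a b' b
    using A that unfolding quasigroup_def by metis
  show ?thesis
    using p
  proof (rule S3_cases)
    assume "p 1 = 1" "p 2 = 2" with eq x y show ?thesis by metis
  next
    assume "p 1 = 1" "p 2 = 3" with eq x y d[of "x 1" "y 2" "x 2"] show ?thesis by simp
  next
    assume "p 1 = 2" "p 2 = 1" with eq x y show ?thesis by metis
  next
    assume "p 1 = 2" "p 2 = 3" with eq x y c[of "x 1" "y 1" "x 2"] show ?thesis by simp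
  next
    assume "p 1 = 3" "p 2 = 1" with eq x y d[of "x 1" "y 2" "x 2"] show ?thesis by simp
  next
    assume "p 1 = 3" "p 2 = 2" with eq x y c[of "x 1" "y 1" "x 2"] show ?thesis by simp
  qed
qed

lemma graph_exists:
  assumes A: "quasigroup Q A" and p: "p \<in> S3" and y: "y1 \<in> Q" "y2 \<in> Q"
  shows "\<exists>x. x ` {1, 2, 3::nat} \<subseteq> Q \<and> A (x 1) (x 2) = x 3 \<and> x (p 1) = y1 \<and> x (p 2) = y2"
proof -
  let ?f = "\<lambda>a b c i. if i = (1::nat) then a else if i = 2 then b else c"
  let ?P = "\<lambda>x. x ` {1, 2, 3::nat} \<subseteq> Q \<and> A (x 1) (x 2) = x 3 \<and> x (p 1) = y1 \<and> x (p 2) = y2"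
  have cl: "A a b \<in> Q" if "a \<in> Q" "b \<in> Q" for a b
    using A that unfolding quasigroup_def by blast
  have l: "\<exists>x\<in>Q. A x a = b" and r: "\<exists>x\<in>Q. A a x = b" if "a \<in> Q" "b \<in> Q" for a b
    using A that unfolding quasigroup_def by metis+
  show ?thesis using p
  proof (rule S3_cases)
    assume "p 1 = 1" "p 2 = 2"
    then have "?P (?f y1 y2 (A y1 y2))" using y cl[OF y] by simp
    then show ?thesis by (rule exI[of ?P])
  next
    assume h: "p 1 = 1" "p 2 = 3"
    obtain b where "b \<in> Q" "A y1 b = y2" using r[OF y] by blast
    with h y have "?P (?f y1 b y2)" by simp
    then show ?thesis by (rule exI[of ?P])
  next
    assume "p 1 = 2" "p 2 = 1"
    then have "?P (?f y2 y1 (A y2 y1))" using y cl[OF y(2,1)] by simp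
    then show ?thesis by (rule exI[of ?P])
  next
    assume h: "p 1 = 2" "p 2 = 3"
    obtain a where "a \<in> Q" "A a y1 = y2" using l[OF y] by blast
    with h y have "?P (?f a y1 y2)" by simp
    then show ?thesis by (rule exI[of ?P])
  next
    assume h: "p 1 = 3" "p 2 = 1"
    obtain b where "b \<in> Q" "A y2 b = y1" using r[OF y(2,1)] by blast
    with h y have "?P (?f y2 b y1)" by simp
    then show ?thesis by (rule exI[of ?P])
  next
    assume h: "p 1 = 3" "p 2 = 2"
    obtain a where "a \<in> Q" "A a y2 = y1" using l[OF y(2,1)] by blast
    with h y have "?P (?f a y2 y1)" by simp
    then show ?thesis by (rule exI[of ?P])
  qed
qed

lemma parastrophe_iff:
  assumes A: "quasigroup Q A" and s: "\<sigma> \<in> S3" and x: "x ` {1, 2, 3} \<subseteq> Q"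
  shows "parastrophe Q A \<sigma> (x (inv \<sigma> 1)) (x (inv \<sigma> 2)) = x (inv \<sigma> 3) \<longleftrightarrow> A (x 1) (x 2) = x 3"
proof -
  have p: "inv \<sigma> \<in> S3" using s permutes_inv by auto
  have x': "x (inv \<sigma> 1) \<in> Q" "x (inv \<sigma> 2) \<in> Q"
    using p x S3_closed[OF p, of 1] S3_closed[OF p, of 2] by blast+
  obtain z where z: "z ` {1, 2, 3} \<subseteq> Q" "A (z 1) (z 2) = z 3"
      "z (inv \<sigma> 1) = x (inv \<sigma> 1)" "z (inv \<sigma> 2) = x (inv \<sigma> 2)"
    using graph_exists[OF A p x'] by blast
  have "parastrophe Q A \<sigma> (x (inv \<sigma> 1)) (x (inv \<sigma> 2)) = z (inv \<sigma> 3)"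
    unfolding parastrophe_def
  proof (rule the_equality)
    fix y3 assume "\<exists>u. u ` {1, 2, 3} \<subseteq> Q \<and> A (u 1) (u 2) = u 3 \<and> u (inv \<sigma> 1) = x (inv \<sigma> 1) \<and>
      u (inv \<sigma> 2) = x (inv \<sigma> 2) \<and> u (inv \<sigma> 3) = y3"
    then obtain u where u: "u ` {1, 2, 3} \<subseteq> Q" "A (u 1) (u 2) = u 3"
      "u (inv \<sigma> 1) = x (inv \<sigma> 1)" "u (inv \<sigma> 2) = x (inv \<sigma> 2)" "u (inv \<sigma> 3) = y3" by blast
    have "u 1 = z 1 \<and> u 2 = z 2 \<and> u 3 = z 3"
      by (rule graph_unique[OF A p]) (use u z in auto)
    then have "u (inv \<sigma> 3) = z (inv \<sigma> 3)" using S3_closed[OF p, of 3] by auto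
    with u(5) show "y3 = z (inv \<sigma> 3)" by simp
  qed (use z in blast)
  moreover have "z (inv \<sigma> 3) = x (inv \<sigma> 3) \<longleftrightarrow> A (x 1) (x 2) = x 3"
  proof
    assume "z (inv \<sigma> 3) = x (inv \<sigma> 3)"
    with z(3,4) have "\<forall>i\<in>{1, 2, 3}. z i = x i"
      unfolding S3_ball[OF p, of "\<lambda>i. z i = x i"] by simp
    then have "z 1 = x 1 \<and> z 2 = x 2 \<and> z 3 = x 3" by simp
    with z(2) show "A (x 1) (x 2) = x 3" by simp
  next
    assume a: "A (x 1) (x 2) = x 3"
    have "z 1 = x 1 \<and> z 2 = x 2 \<and> z 3 = x 3"
      by (rule graph_unique[OF A p]) (use x a z in auto)
    then show "z (inv \<sigma> 3) = x (inv \<sigma> 3)" using S3_closed[OF p, of 3] by auto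
  qed
  ultimately show ?thesis by simp
qed

lemma component_simps [simp]:
  "component 1 (a, b, c) = a" "component (Suc 0) (a, b, c) = a"
  "component 2 (a, b, c) = b" "component 3 (a, b, c) = c"
  by (simp_all add: component_def)

lemma perm_triples_iff:
  "T \<in> perm_triples Q \<longleftrightarrow> component 1 T permutes Q \<and> component 2 T permutes Q \<and>
     component 3 T permutes Q"
  by (cases T) (simp add: perm_triples_def component_def)

lemma perm_triples_component: "T \<in> perm_triples Q \<Longrightarrow> component i T permutes Q"
  by (cases T) (simp add: perm_triples_def component_def)

lemma isostrophic_image_iff:
  assumes A: "quasigroup Q A" and s: "\<sigma> \<in> S3" and T: "T \<in> perm_triples Q"
    and z: "z ` {1, 2, 3} \<subseteq> Q"
  shows "isostrophic_image Q A (\<sigma>, T) (z 1) (z 2) = z 3 \<longleftrightarrow>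
    A (component (\<sigma> 1) T (z (\<sigma> 1))) (component (\<sigma> 2) T (z (\<sigma> 2))) = component (\<sigma> 3) T (z (\<sigma> 3))"
proof -
  define x where "x = (\<lambda>i. component (\<sigma> i) T (z (\<sigma> i)))"
  have "x ` {1, 2, 3} \<subseteq> Q"
  proof (rule image_subsetI)
    fix i :: nat assume "i \<in> {1, 2, 3}"
    then have "z (\<sigma> i) \<in> Q" using S3_closed[OF s] z by blast
    then show "x i \<in> Q" by (simp add: x_def permutes_in_image[OF perm_triples_component[OF T]])
  qed
  note parastrophe_iff[OF A s this]
  moreover have "x (inv \<sigma> i) = component i T (z i)" for i
    using s by (simp add: x_def permutes_inverses)
  moreover have "inv (component 3 T) w = z 3 \<longleftrightarrow> w = component 3 T (z 3)" for w
    using permutes_inv_eq[OF perm_triples_component[OF T]] by metis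
  ultimately show ?thesis by (simp add: isostrophic_image_def x_def)
qed

lemma Aus_iff:
  assumes A: "quasigroup Q A"
  shows "(\<sigma>, T) \<in> Aus Q A \<longleftrightarrow> \<sigma> \<in> S3 \<and> T \<in> perm_triples Q \<and>
    (\<forall>z. z ` {1, 2, 3} \<subseteq> Q \<longrightarrow> (A (z 1) (z 2) = z 3 \<longleftrightarrow>
      A (component (\<sigma> 1) T (z (\<sigma> 1))) (component (\<sigma> 2) T (z (\<sigma> 2))) = component (\<sigma> 3) T (z (\<sigma> 3))))"
    (is "_ \<longleftrightarrow> _ \<and> _ \<and> ?P")
proof (cases "\<sigma> \<in> S3 \<and> T \<in> perm_triples Q")
  case True
  then have s: "\<sigma> \<in> S3" and T: "T \<in> perm_triples Q" by auto
  note iff = isostrophic_image_iff[OF A s T]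
  let ?B = "isostrophic_image Q A (\<sigma>, T)"
  have "(\<forall>a\<in>Q. \<forall>b\<in>Q. ?B a b = A a b) \<longleftrightarrow>
        (\<forall>z. z ` {1, 2, 3} \<subseteq> Q \<longrightarrow> (A (z 1) (z 2) = z (3::nat) \<longleftrightarrow> ?B (z 1) (z 2) = z 3))"
  proof (intro iffI ballI)
    fix a b assume h: "\<forall>z. z ` {1, 2, 3} \<subseteq> Q \<longrightarrow> (A (z 1) (z 2) = z (3::nat) \<longleftrightarrow> ?B (z 1) (z 2) = z 3)"
      and ab: "a \<in> Q" "b \<in> Q"
    have "A a b \<in> Q" using A ab unfolding quasigroup_def by blast
    then show "?B a b = A a b"
      using h[rule_format, of "\<lambda>i. if i = 1 then a else if i = 2 then b else A a b"] ab by auto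
  qed auto
  with True iff show ?thesis by (simp add: Aus_def)
qed (auto simp: Aus_def)

lemma pair_one_in_Aus: "quasigroup Q A \<Longrightarrow> pair_one \<in> Aus Q A"
  by (simp add: pair_one_def Aus_iff perm_triples_iff permutes_id)

lemma pair_mult_in_Aus:
  assumes A: "quasigroup Q A" and p: "p \<in> Aus Q A" and q: "q \<in> Aus Q A"
  shows "pair_mult p q \<in> Aus Q A"
proof -
  obtain \<sigma> T \<tau> U where pq: "p = (\<sigma>, T)" "q = (\<tau>, U)" by (metis surj_pair)
  have 1: "\<sigma> \<in> S3" "T \<in> perm_triples Q" "\<tau> \<in> S3" "U \<in> perm_triples Q"
    using p q unfolding pq Aus_iff[OF A] by auto
  let ?V = "triple_mult (triple_permute T \<tau>) U"
  have inj: "inv \<tau> (\<tau> i) = i" for i using 1(3) by (simp add: permutes_inverses)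
  have c: "component (\<tau> (\<sigma> i)) ?V = component (\<sigma> i) T \<circ> component (\<tau> (\<sigma> i)) U" if "i \<in> {1,2,3}" for i
  proof -
    have "\<tau> (\<sigma> i) \<in> {1, 2, 3}" using S3_closed 1(1,3) that by blast
    then show ?thesis using inj[of "\<sigma> i"] by (auto simp: triple_mult_def triple_permute_def)
  qed
  have "?V \<in> perm_triples Q"
    unfolding perm_triples_iff triple_mult_def triple_permute_def
    by (simp add: permutes_compose perm_triples_component 1)
  moreover have "S3_mult \<sigma> \<tau> \<in> S3"
    using permutes_compose[of \<sigma> _ \<tau>] 1(1,3) by (simp add: S3_mult_def comp_def)
  moreover have "A (z 1) (z 2) = z 3 \<longleftrightarrow>
      A (component (\<tau> (\<sigma> 1)) ?V (z (\<tau> (\<sigma> 1)))) (component (\<tau> (\<sigma> 2)) ?V (z (\<tau> (\<sigma> 2))))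
        = component (\<tau> (\<sigma> 3)) ?V (z (\<tau> (\<sigma> 3)))"
    if z: "z ` {1, 2, 3} \<subseteq> Q" for z
  proof -
    let ?w = "\<lambda>i. component (\<tau> i) U (z (\<tau> i))"
    have w: "?w ` {1, 2, 3} \<subseteq> Q"
    proof (rule image_subsetI)
      fix i :: nat assume "i \<in> {1, 2, 3}"
      then have "z (\<tau> i) \<in> Q" using S3_closed[OF 1(3)] z by blast
      then show "?w i \<in> Q" by (simp add: permutes_in_image[OF perm_triples_component[OF 1(4)]])
    qed
    have "A (z 1) (z 2) = z 3 \<longleftrightarrow> A (?w 1) (?w 2) = ?w 3"
      using q z unfolding pq Aus_iff[OF A] by blast
    also have "\<dots> \<longleftrightarrow> A (component (\<sigma> 1) T (?w (\<sigma> 1))) (component (\<sigma> 2) T (?w (\<sigma> 2)))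
        = component (\<sigma> 3) T (?w (\<sigma> 3))"
      using p w unfolding pq Aus_iff[OF A] by blast
    finally show ?thesis using c by simp
  qed
  ultimately show ?thesis
    unfolding pq pair_mult_def by (simp add: Aus_iff[OF A] S3_mult_def)
qed

lemma pair_inv_in_Aus:
  assumes A: "quasigroup Q A" and p: "p \<in> Aus Q A"
  shows "pair_inv p \<in> Aus Q A"
proof -
  obtain \<sigma> T where pq: "p = (\<sigma>, T)" by (metis surj_pair)
  have 1: "\<sigma> \<in> S3" "T \<in> perm_triples Q"
    using p unfolding pq Aus_iff[OF A] by auto
  have s: "inv \<sigma> \<in> S3" using 1(1) permutes_inv by auto
  have ii: "inv (inv \<sigma>) = \<sigma>" using 1(1) permutes_inv_inv by auto
  have i: "\<sigma> (inv \<sigma> i) = i" "inv \<sigma> (\<sigma> i) = i" for i using 1(1) by (simp_all add: permutes_inverses)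
  let ?V = "triple_permute (triple_inv T) (inv \<sigma>)"
  have c: "component i ?V = inv (component (\<sigma> i) T)" if "i \<in> {1,2,3}" for i
  proof -
    have "\<sigma> i \<in> {1, 2, 3}" using S3_closed[OF 1(1) that] .
    then have "component (\<sigma> i) (triple_inv T) = inv (component (\<sigma> i) T)"
      by (auto simp: triple_inv_def)
    then show ?thesis using that by (auto simp: triple_permute_def ii)
  qed
  have V: "?V \<in> perm_triples Q"
    unfolding perm_triples_iff using c 1(2) by (simp add: perm_triples_component permutes_inv)
  moreover have "A (z 1) (z 2) = z 3 \<longleftrightarrow>
      A (component (inv \<sigma> 1) ?V (z (inv \<sigma> 1))) (component (inv \<sigma> 2) ?V (z (inv \<sigma> 2)))
        = component (inv \<sigma> 3) ?V (z (inv \<sigma> 3))"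
    if z: "z ` {1, 2, 3} \<subseteq> Q" for z
  proof -
    let ?w = "\<lambda>i. component (inv \<sigma> i) ?V (z (inv \<sigma> i))"
    have w: "?w ` {1, 2, 3} \<subseteq> Q"
    proof (rule image_subsetI)
      fix i :: nat assume "i \<in> {1, 2, 3}"
      then have "z (inv \<sigma> i) \<in> Q" using S3_closed[OF s] z by blast
      then show "?w i \<in> Q" by (simp add: permutes_in_image[OF perm_triples_component[OF V]])
    qed
    have "component (\<sigma> k) T (?w (\<sigma> k)) = z k" if "k \<in> {1,2,3}" for k
      using c[OF that] permutes_inverses[OF perm_triples_component[OF 1(2)]] i by simp
    moreover have "A (?w 1) (?w 2) = ?w 3 \<longleftrightarrow>
        A (component (\<sigma> 1) T (?w (\<sigma> 1))) (component (\<sigma> 2) T (?w (\<sigma> 2)))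
        = component (\<sigma> 3) T (?w (\<sigma> 3))"
      using p w unfolding pq Aus_iff[OF A] by blast
    ultimately show ?thesis by simp
  qed
  ultimately show ?thesis
    using s unfolding pq pair_inv_def by (simp add: Aus_iff[OF A])
qed

lemma triple_eqI:
  assumes "\<And>i. i \<in> {1, 2, 3} \<Longrightarrow> component i T = component i U"
  shows "T = U"
  using assms[of 1] assms[of 2] assms[of 3] by (cases T; cases U) simp

lemma pair_mult_inv:
  assumes "quasigroup Q A" and "p \<in> Aus Q A"
  shows "pair_mult p (pair_inv p) = pair_one" and "pair_mult (pair_inv p) p = pair_one"
proof -
  obtain \<sigma> T where pq: "p = (\<sigma>, T)" by (metis surj_pair)
  have 1: "\<sigma> \<in> S3" "T \<in> perm_triples Q"
    using assms(2) unfolding pq Aus_iff[OF assms(1)] by auto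
  have s: "inv \<sigma> \<in> S3" using 1(1) permutes_inv by auto
  have ii: "inv (inv \<sigma>) = \<sigma>" using 1(1) permutes_inv_inv by auto
  have i: "\<sigma> (inv \<sigma> k) = k" "inv \<sigma> (\<sigma> k) = k" for k using 1(1) by (simp_all add: permutes_inverses)
  have r: "component k T \<circ> inv (component k T) = id" "inv (component k T) \<circ> component k T = id" for k
    using permutes_inv_o[OF perm_triples_component[OF 1(2)]] by auto
  have c: "component k (triple_permute U \<tau>) = component (inv \<tau> k) U" if "k \<in> {1,2,3}"
    for k \<tau> and U :: "'a triple"
    using that by (auto simp: triple_permute_def)
  have d: "component k (triple_mult U V) = component k U \<circ> component k V"
    "component k (triple_inv U) = inv (component k U)" if "k \<in> {1,2,3}" for k and U V :: "'a triple"
    using that by (auto simp: triple_mult_def triple_inv_def)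
  have m: "\<sigma> k \<in> {1,2,3}" "inv \<sigma> k \<in> {1,2,3}" if "k \<in> {1,2,3}" for k
    using that S3_closed[OF 1(1)] S3_closed[OF s] by blast+
  have e: "component k (id, id, id) = id" if "k \<in> {1,2,3}" for k using that by auto
  have "triple_mult (triple_permute T (inv \<sigma>)) (triple_permute (triple_inv T) (inv \<sigma>)) = (id, id, id)"
    by (rule triple_eqI) (simp only: c d e m ii r)
  then show "pair_mult p (pair_inv p) = pair_one"
    by (simp add: pq pair_mult_def pair_inv_def pair_one_def S3_mult_def fun_eq_iff i)
  have "triple_mult (triple_permute (triple_permute (triple_inv T) (inv \<sigma>)) \<sigma>) T = (id, id, id)"
    by (rule triple_eqI) (simp only: c d e m ii i r)
  then show "pair_mult (pair_inv p) p = pair_one"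
    by (simp add: pq pair_mult_def pair_inv_def pair_one_def S3_mult_def fun_eq_iff i)
qed

end

theory Submission
  imports Defs
begin

text \<open>A nucleus is cut out of the autostrophisms by requiring one component of the triple to be the
  identity: component 1 for the right, 2 for the left and 3 for the middle nucleus.  Inverting
  \<open>(\<sigma>, T)\<close> inverts every component of \<open>T\<close> and moves it from position \<open>j\<close> to position \<open>\<sigma>\<^sup>-\<^sup>1 j\<close>
  (\<open>component_pair_inv\<close>).  A trivial component \<open>j\<close> thus becomes a trivial component \<open>\<sigma>\<^sup>-\<^sup>1 j\<close>, so
  inversion maps the nucleus belonging to \<open>j\<close> and \<open>\<sigma>\<close> into the one belonging to \<open>\<sigma>\<^sup>-\<^sup>1 j\<close> and
  \<open>\<sigma>\<^sup>-\<^sup>1\<close>.  The same statement for \<open>\<sigma>\<^sup>-\<^sup>1\<close> leads back, and inversion is an involution, so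
  the inclusion is an equality (\<open>pair_inv_image_nucleus\<close>).  The claims about component sets follow
  by reading off the \<open>\<sigma>\<^sup>-\<^sup>1 k\<close>-th components of both sides.\<close>

lemma mem_nucleus_iff:
  assumes "j \<in> {1, 2, 3}"
  shows "(\<tau>, T) \<in> nucleus (side_of j) Q A \<sigma> \<longleftrightarrow>
    (\<tau>, T) \<in> Aus Q A \<and> \<tau> = \<sigma> \<and> component j T = id"
  using assms by (cases T) (auto simp: side_of_def)

text \<open>Indexing by \<open>\<sigma>\<^sup>-\<^sup>1 k\<close> lets the two permutations of positions cancel, so that no case
  distinction on \<open>\<sigma>\<close> is ever needed.\<close>

lemma component_pair_inv:
  assumes s: "\<sigma> \<in> S3" and k: "k \<in> {1, 2, 3}"
  shows "component (inv \<sigma> k) (snd (pair_inv (\<sigma>, T))) = inv (component k T)"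
proof -
  have p: "\<sigma> permutes {1, 2, 3}" using s by simp
  have "inv \<sigma> k \<in> {1, 2, 3}" using S3_closed permutes_inv[OF p] k by blast
  then have "component (inv \<sigma> k) (triple_permute (triple_inv T) (inv \<sigma>))
      = component (\<sigma> (inv \<sigma> k)) (triple_inv T)"
    by (auto simp: triple_permute_def permutes_inv_inv[OF p])
  also have "\<dots> = inv (component k T)"
    using k by (auto simp: permutes_inverses[OF p] triple_inv_def)
  finally show ?thesis by (simp add: pair_inv_def)
qed

lemma pair_inv_pair_inv:
  assumes s: "\<sigma> \<in> S3" and T: "T \<in> perm_triples Q"
  shows "pair_inv (pair_inv (\<sigma>, T)) = (\<sigma>, T)"
proof -
  have p: "\<sigma> permutes {1, 2, 3}" using s by simp
  have s': "inv \<sigma> \<in> S3" using permutes_inv[OF p] by simp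
  let ?U = "snd (pair_inv (\<sigma>, T))"
  have pU: "pair_inv (\<sigma>, T) = (inv \<sigma>, ?U)" by (simp add: pair_inv_def)
  have "snd (pair_inv (inv \<sigma>, ?U)) = T"
  proof (rule triple_eqI)
    fix k :: nat assume k: "k \<in> {1, 2, 3}"
    have "component (inv (inv \<sigma>) (inv \<sigma> k)) (snd (pair_inv (inv \<sigma>, ?U)))
        = inv (component (inv \<sigma> k) ?U)"
      by (rule component_pair_inv[OF s' S3_closed[OF s' k]])
    also have "\<dots> = component k T"
      by (simp add: component_pair_inv[OF s k] permutes_inv_inv[OF perm_triples_component[OF T]])
    finally show "component k (snd (pair_inv (inv \<sigma>, ?U))) = component k T"
      by (simp add: permutes_inv_inv[OF p] permutes_inverses[OF p])
  qed
  moreover have "fst (pair_inv (inv \<sigma>, ?U)) = \<sigma>"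
    by (simp add: pair_inv_def permutes_inv_inv[OF p])
  ultimately show ?thesis by (subst pU) (metis prod.collapse)
qed

lemma nucleus_imp_perm_triples:
  assumes "(\<tau>, T) \<in> nucleus (side_of j) Q A \<sigma>"
  shows "T \<in> perm_triples Q"
  using assms by (cases "side_of j") (auto simp: Aus_def)

lemma pair_inv_nucleus_subset:
  assumes A: "quasigroup Q A" and s: "\<sigma> \<in> S3" and j: "j \<in> {1, 2, 3}"
  shows "pair_inv ` nucleus (side_of j) Q A \<sigma> \<subseteq> nucleus (side_of (inv \<sigma> j)) Q A (inv \<sigma>)"
proof (rule image_subsetI)
  fix p assume p: "p \<in> nucleus (side_of j) Q A \<sigma>"
  obtain T where pT: "p = (\<sigma>, T)" and Aus: "(\<sigma>, T) \<in> Aus Q A" and id: "component j T = id"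
    using p mem_nucleus_iff[OF j] by (metis surj_pair)
  let ?U = "snd (pair_inv (\<sigma>, T))"
  have pU: "pair_inv (\<sigma>, T) = (inv \<sigma>, ?U)" by (simp add: pair_inv_def)
  have "inv \<sigma> j \<in> {1, 2, 3}" using S3_closed permutes_inv s j by blast
  moreover have "component (inv \<sigma> j) ?U = id" by (simp add: component_pair_inv[OF s j] id)
  moreover have "(inv \<sigma>, ?U) \<in> Aus Q A" using pair_inv_in_Aus[OF A Aus] by (subst (asm) pU)
  ultimately show "pair_inv p \<in> nucleus (side_of (inv \<sigma> j)) Q A (inv \<sigma>)"
    unfolding pT by (subst pU) (simp add: mem_nucleus_iff)
qed

lemma pair_inv_image_nucleus:
  assumes A: "quasigroup Q A" and s: "\<sigma> \<in> S3" and j: "j \<in> {1, 2, 3}"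
  shows "pair_inv ` nucleus (side_of j) Q A \<sigma> = nucleus (side_of (inv \<sigma> j)) Q A (inv \<sigma>)"
    (is "_ = ?N")
proof (rule equalityI[OF pair_inv_nucleus_subset[OF assms]], rule subsetI)
  have p: "\<sigma> permutes {1, 2, 3}" using s by simp
  have s': "inv \<sigma> \<in> S3" using permutes_inv[OF p] by simp
  have j': "inv \<sigma> j \<in> {1, 2, 3}" by (rule S3_closed[OF s' j])
  fix q assume q: "q \<in> ?N"
  obtain T where qT: "q = (inv \<sigma>, T)" using q mem_nucleus_iff[OF j'] by (metis surj_pair)
  have "T \<in> perm_triples Q" using q unfolding qT by (rule nucleus_imp_perm_triples)
  then have "q = pair_inv (pair_inv q)" unfolding qT by (rule pair_inv_pair_inv[OF s', symmetric])
  moreover have "pair_inv q \<in> nucleus (side_of j) Q A \<sigma>"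
    using pair_inv_nucleus_subset[OF A s' j'] q
    by (auto simp: permutes_inv_inv[OF p] permutes_inverses[OF p])
  ultimately show "q \<in> pair_inv ` nucleus (side_of j) Q A \<sigma>" by blast
qed

lemma inv_image_nucleus_component:
  assumes A: "quasigroup Q A" and s: "\<sigma> \<in> S3" and j: "j \<in> {1, 2, 3}" and k: "k \<in> {1, 2, 3}"
  shows "inv ` nucleus_component k (side_of j) Q A \<sigma>
    = nucleus_component (inv \<sigma> k) (side_of (inv \<sigma> j)) Q A (inv \<sigma>)"
proof -
  have "inv (component k (snd p)) = component (inv \<sigma> k) (snd (pair_inv p))"
    if "p \<in> nucleus (side_of j) Q A \<sigma>" for p
    using that component_pair_inv[OF s k] mem_nucleus_iff[OF j] by (metis snd_conv surj_pair)
  then show ?thesis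
    unfolding nucleus_component_def pair_inv_image_nucleus[OF A s j, symmetric]
    by (simp add: image_image case_prod_beta cong: image_cong)
qed

theorem theorem2:
  fixes Q :: "'a set" and A :: "'a \<Rightarrow> 'a \<Rightarrow> 'a" and \<sigma> :: "nat \<Rightarrow> nat"
  assumes "quasigroup Q A" and "\<sigma> \<in> S3"
  shows "(pair_inv ` nucleus Left Q A \<sigma> = nucleus (side_of (inv \<sigma> 2)) Q A (inv \<sigma>) \<and>
          inv ` nucleus_component 1 Left Q A \<sigma>
            = nucleus_component (inv \<sigma> 1) (side_of (inv \<sigma> 2)) Q A (inv \<sigma>) \<and>
          inv ` nucleus_component 3 Left Q A \<sigma>
            = nucleus_component (inv \<sigma> 3) (side_of (inv \<sigma> 2)) Q A (inv \<sigma>)) \<and>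
         (pair_inv ` nucleus Right Q A \<sigma> = nucleus (side_of (inv \<sigma> 1)) Q A (inv \<sigma>) \<and>
          inv ` nucleus_component 2 Right Q A \<sigma>
            = nucleus_component (inv \<sigma> 2) (side_of (inv \<sigma> 1)) Q A (inv \<sigma>) \<and>
          inv ` nucleus_component 3 Right Q A \<sigma>
            = nucleus_component (inv \<sigma> 3) (side_of (inv \<sigma> 1)) Q A (inv \<sigma>)) \<and>
         (pair_inv ` nucleus Middle Q A \<sigma> = nucleus (side_of (inv \<sigma> 3)) Q A (inv \<sigma>) \<and>
          inv ` nucleus_component 1 Middle Q A \<sigma>
            = nucleus_component (inv \<sigma> 1) (side_of (inv \<sigma> 3)) Q A (inv \<sigma>) \<and>
          inv ` nucleus_component 2 Middle Q A \<sigma>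
            = nucleus_component (inv \<sigma> 2) (side_of (inv \<sigma> 3)) Q A (inv \<sigma>))"
proof -
  have side: "side_of 1 = Right" "side_of 2 = Left" "side_of 3 = Middle"
    by (simp_all add: side_of_def)
  note N = pair_inv_image_nucleus[OF assms]
  note C = inv_image_nucleus_component[OF assms]
  show ?thesis
    by (intro conjI N[of 2, unfolded side] C[of 2 1, unfolded side] C[of 2 3, unfolded side]
        N[of 1, unfolded side] C[of 1 2, unfolded side] C[of 1 3, unfolded side]
        N[of 3, unfolded side] C[of 3 1, unfolded side] C[of 3 2, unfolded side]) simp_all
qed

end
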